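(* The method EP for the charged-particle system $\ddot{x}=\dot{x}\times B(x)+F(x)$ (defined in the context) is symmetric; that is, exchanging $x_n\leftrightarrow x_{n+1}$, $v_n\leftrightarrow v_{n+1}$ and $h\leftrightarrow -h$ does not change the scheme of the method.
   Context: Charged-particle dynamics: $x(t)\in\mathbb{R}^3$ solves $\ddot{x}=\dot{x}\times B(x)+F(x)$, where $B(x)=\nabla_x\times A(x)$ for a vector potential $A(x)\in\mathbb{R}^3$ and $F(x)=-\nabla U(x)$ for a scalar potential $U(x)\in\mathbb{R}$. Write $v=\dot{x}$ and $B=(B_1,B_2,B_3)^{\intercal}$, and let $$\tilde{B}(x)=\begin{pmatrix}0&B_3(x)&-B_2(x)\\-B_3(x)&0&B_1(x)\\ B_2(x)&-B_1(x)&0\end{pmatrix},$$ so that $\dot{x}\times B(x)=\tilde{B}(x)\dot{x}$. Method EP: for stepsize $h$, $(x_{n+1},v_{n+1})$ is defined implicitly from $(x_n,v_n)$ by $$x_{n+1}=x_n+hv_n+\tfrac{h^2}{2}\int_0^1F(x_n+\tau(x_{n+1}-x_n))\,d\tau+\tfrac{h^2}{2}\tilde{B}\big(\tfrac{x_{n+1}+x_n}{2}\big)\tfrac{v_{n+1}+v_n}{2},$$ $$v_{n+1}=v_n+h\int_0^1F(x_n+\tau(x_{n+1}-x_n))\,d\tau+h\tilde{B}\big(\tfrac{x_{n+1}+x_n}{2}\big)\tfrac{v_{n+1}+v_n}{2}.$$ Symmetry: a one-step method $y_{n+1}=\Phi_h(y_n)$ is called symmetric if exchanging $y_n\leftrightarrow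 y_{n+1}$ and $h\leftrightarrow-h$ does not change the scheme; here $y_n=(x_n,v_n)$, so this means that $(x_n,v_n),(x_{n+1},v_{n+1})$ satisfy the defining equations with stepsize $h$ if and only if the equations obtained by the exchange hold. *)

theory Defs
  imports "HOL-Analysis.Analysis"
begin

definition curl :: "(real^3 \<Rightarrow> real^3) \<Rightarrow> real^3 \<Rightarrow> real^3" where
  "curl A x = (let J = jacobian A (at x) in
     vector [J$3$2 - J$2$3, J$1$3 - J$3$1, J$2$1 - J$1$2])"

definition B_tilde :: "(real^3 \<Rightarrow> real^3) \<Rightarrow> real^3 \<Rightarrow> real^3^3" where
  "B_tilde B x = vector [
     vector [0, B x $ 3, - (B x $ 2)],
     vector [- (B x $ 3), 0, B x $ 1],
     vector [B x $ 2, - (B x $ 1), 0]]"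

lemma B_tilde_mult: "B_tilde B x *v v = cross3 v (B x)"
  by (simp add: B_tilde_def cross3_def matrix_vector_mult_def vec_eq_iff forall_3 sum_3 vector_def)

text \<open>An implicit one-step method is given by the relation \<open>\<Phi> h y y'\<close> that its defining
  equations impose on the stepsize \<open>h\<close>, the current state \<open>y\<close> and the next state \<open>y'\<close>;
  neither existence nor uniqueness of \<open>y'\<close> is required.\<close>

definition symmetric_method :: "(real \<Rightarrow> 'y \<Rightarrow> 'y \<Rightarrow> bool) \<Rightarrow> bool" where
  "symmetric_method \<Phi> \<longleftrightarrow> (\<forall>h y y'. \<Phi> h y y' \<longleftrightarrow> \<Phi> (- h) y' y)"

definition method_EP ::
  "(real^3 \<Rightarrow> real^3) \<Rightarrow> (real^3 \<Rightarrow> real^3) \<Rightarrow> real \<Rightarrow>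
   (real^3) \<times> (real^3) \<Rightarrow> (real^3) \<times> (real^3) \<Rightarrow> bool" where
  "method_EP B F h = (\<lambda>(x, v) (x', v').
     x' = x + h *\<^sub>R v
       + (h\<^sup>2 / 2) *\<^sub>R integral {0..1} (\<lambda>\<tau>. F (x + \<tau> *\<^sub>R (x' - x)))
       + (h\<^sup>2 / 2) *\<^sub>R (B_tilde B ((1/2) *\<^sub>R (x' + x)) *v ((1/2) *\<^sub>R (v' + v))) \<and>
     v' = v
       + h *\<^sub>R integral {0..1} (\<lambda>\<tau>. F (x + \<tau> *\<^sub>R (x' - x)))
       + h *\<^sub>R (B_tilde B ((1/2) *\<^sub>R (x' + x)) *v ((1/2) *\<^sub>R (v' + v))))"

end

theory Submission
  imports Defs
begin

text \<open>Both equations of the method have the form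
  \<open>x' = x + h v + (h\<^sup>2/2) G\<close>, \<open>v' = v + h G\<close> with a single vector
  \<open>G = \<integral>\<^sub>0\<^sup>1 F (x + \<tau> (x' - x)) d\<tau> + B_tilde B ((x' + x)/2) ((v' + v)/2)\<close>.
  This \<open>G\<close> is invariant under exchanging the two states: the midpoints are symmetric, and the
  substitution \<open>\<tau> \<mapsto> 1 - \<tau>\<close> reverses the segment along which \<open>F\<close> is averaged
  (\<open>average_along_segment_commute\<close>). For a fixed \<open>G\<close> the two equations describe motion with
  constant acceleration \<open>G\<close> during time \<open>h\<close>, which is undone by running it for time \<open>- h\<close>
  (\<open>uniform_acceleration_reverse\<close>).\<close>

lemma has_integral_reflect_unit_interval:
  fixes f :: "real \<Rightarrow> 'a::real_normed_vector"
  assumes "(f has_integral i) {0..1}"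
  shows "((\<lambda>t. f (1 - t)) has_integral i) {0..1}"
proof -
  have "((\<lambda>t. f ((-1) *\<^sub>R t + 1)) has_integral (1 / \<bar>-1\<bar> ^ DIM(real)) *\<^sub>R i)
          ((\<lambda>t. (1 / (-1)) *\<^sub>R t + - ((1 / (-1)) *\<^sub>R 1)) ` cbox 0 1)"
    using assms by (intro has_integral_affinity) auto
  moreover have "(\<lambda>t::real. (1 / (-1)) *\<^sub>R t + - ((1 / (-1)) *\<^sub>R 1)) ` cbox 0 1 = {0..1}"
    using image_diff_atLeastAtMost[of "1::real" 0 1] by simp
  ultimately show ?thesis
    by (simp add: algebra_simps)
qed

text \<open>Reflection is an involution, so a function is integrable on \<open>[0, 1]\<close> exactly when its
  reflection is; in the non-integrable case both integrals take the default value \<open>0\<close>.\<close>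

lemma integral_reflect_unit_interval:
  fixes f :: "real \<Rightarrow> 'a::real_normed_vector"
  shows "integral {0..1} (\<lambda>t. f (1 - t)) = integral {0..1} f"
proof -
  have "((\<lambda>t. f (1 - t)) has_integral i) {0..1} \<longleftrightarrow> (f has_integral i) {0..1}" for i
    using has_integral_reflect_unit_interval[of f i]
      has_integral_reflect_unit_interval[of "\<lambda>t. f (1 - t)" i]
    by auto
  then show ?thesis
    by (simp add: integral_def integrable_on_def)
qed

lemma average_along_segment_commute:
  fixes F :: "'a::real_vector \<Rightarrow> 'b::real_normed_vector"
  shows "integral {0..1} (\<lambda>t. F (y + t *\<^sub>R (x - y))) = integral {0..1} (\<lambda>t. F (x + t *\<^sub>R (y - x)))"
proof -
  have "y + t *\<^sub>R (x - y) = x + (1 - t) *\<^sub>R (y - x)" for t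
    by (simp add: algebra_simps)
  then show ?thesis
    using integral_reflect_unit_interval[of "\<lambda>t. F (x + t *\<^sub>R (y - x))"] by simp
qed

text \<open>Substituting \<open>v = v' - h G\<close> turns the term \<open>h v\<close> into \<open>h v' - h\<^sup>2 G\<close>; together with
  \<open>(h\<^sup>2/2) G\<close> this leaves \<open>- (h\<^sup>2/2) G\<close>, which is the sign needed after moving it to the other
  side.\<close>

lemma uniform_acceleration_reverse:
  fixes x v x' v' G :: "'a::real_vector"
  assumes "x' = x + h *\<^sub>R v + (h\<^sup>2 / 2) *\<^sub>R G" and "v' = v + h *\<^sub>R G"
  shows "x = x' + (- h) *\<^sub>R v' + ((- h)\<^sup>2 / 2) *\<^sub>R G" and "v = v' + (- h) *\<^sub>R G"
proof -
  have "h *\<^sub>R h *\<^sub>R G = (h\<^sup>2 / 2) *\<^sub>R G + (h\<^sup>2 / 2) *\<^sub>R G"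
    by (simp add: power2_eq_square flip: scaleR_left_distrib)
  then show "x = x' + (- h) *\<^sub>R v' + ((- h)\<^sup>2 / 2) *\<^sub>R G"
    unfolding assms by (simp add: scaleR_right_distrib)
  show "v = v' + (- h) *\<^sub>R G"
    unfolding assms by simp
qed

lemma method_EP_reverse:
  assumes "method_EP B F h (x, v) (x', v')"
  shows "method_EP B F (- h) (x', v') (x, v)"
proof -
  define G where "G = integral {0..1} (\<lambda>\<tau>. F (x + \<tau> *\<^sub>R (x' - x)))
    + B_tilde B ((1/2) *\<^sub>R (x' + x)) *v ((1/2) *\<^sub>R (v' + v))"
  have G_exchanged: "G = integral {0..1} (\<lambda>\<tau>. F (x' + \<tau> *\<^sub>R (x - x')))
    + B_tilde B ((1/2) *\<^sub>R (x + x')) *v ((1/2) *\<^sub>R (v + v'))"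
    unfolding G_def average_along_segment_commute[of F x' x] by (simp only: add.commute)
  have "x' = x + h *\<^sub>R v + (h\<^sup>2 / 2) *\<^sub>R G" "v' = v + h *\<^sub>R G"
    using assms unfolding method_EP_def G_def prod.case
    by (simp_all only: scaleR_right_distrib[of _ "integral _ _"] add.assoc)
  from uniform_acceleration_reverse[OF this] show ?thesis
    unfolding method_EP_def prod.case G_exchanged
    by (simp only: scaleR_right_distrib[of _ "integral _ _"] add.assoc)
qed

theorem theorem2p4:
  fixes A B F :: "real^3 \<Rightarrow> real^3" and U :: "real^3 \<Rightarrow> real"
  assumes "\<And>x. A differentiable (at x)"
    and "\<And>x. B x = curl A x"
    and "\<And>x. GDERIV U x :> - F x"
  shows "symmetric_method (method_EP B F)"
  unfolding symmetric_method_def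
proof (intro allI iffI)
  fix h and y y' :: "(real^3) \<times> (real^3)"
  show "method_EP B F (- h) y' y" if "method_EP B F h y y'"
    using method_EP_reverse that by (metis surj_pair)
  show "method_EP B F h y y'" if "method_EP B F (- h) y' y"
    using method_EP_reverse that by (metis surj_pair minus_minus)
qed

end
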